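(* Let $T>0$, $I=[0,T]$, and let $\alpha,\beta:I\to(0,1]$ be continuous (time-varying memory exponents). For any $x_1,x_2\in\mathcal{C}^1(I)$ and any $c_1,c_2\in\mathbb{R}$, $$\mathscr{V}_{\alpha,\beta}[c_1x_1+c_2x_2]=c_1\mathscr{V}_{\alpha,\beta}[x_1]+c_2\mathscr{V}_{\alpha,\beta}[x_2].$$ That is, for fixed $\alpha,\beta$, the mapping $\mathscr{V}_{\alpha,\beta}:\mathcal{C}^1(I)\to\mathcal{F}(I)$ is a linear operator, where $\mathcal{F}(I)$ is the set of all real-valued functions on $I$.
   Context: $\mathcal{C}^1(I)$ is the space of continuously differentiable real-valued functions on $I=[0,T]$ (one-sided derivatives at the endpoints). A time-varying memory exponent is a continuous function $\varrho:I\to\mathbb{R}$ with $\varrho(t)\in(0,1]$ for all $t\in I$. Its memory kernel is $K_\varrho(t,\tau)=\frac{(t-\tau)^{\varrho(t)-1}}{\Gamma(\varrho(t))}$ for $0\le\tau<t\le T$, and $K_\varrho(t,\tau)=0$ for $\tau\ge t$, where $\Gamma$ is the Gamma function. For memory exponents $\alpha,\beta$ and $x\in\mathcal{C}^1(I)$, the memory-weighted velocity operator is the function $\mathscr{V}_{\alpha,\beta}[x]:I\to\mathbb{R}$ given by $$\mathscr{V}_{\alpha,\beta}[x](t)=\frac{\int_0^t K_\alpha(t,\tau)\,[x(t)-x(\tau)]\,d\tau}{\int_0^t K_\beta(t,\tau)\,(t-\tau)\,d\tau}\quad (t\in(0,T]),\qquad \mathscr{V}_{\alpha,\beta}[x](0)=\dot{x}(0).$$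 *)

theory Defs
  imports "HOL-Analysis.Analysis" "HOL-Library.FuncSet"
begin

text \<open>
  Real functions on \<open>I\<close> are represented by the total functions in \<open>extensional I\<close>, so that
  equality of functions on \<open>I\<close> is equality in HOL and pointwise operations have the
  form \<open>\<lambda>t\<in>I. \<dots>\<close>.
\<close>

abbreviation (input) functions_on :: "real set \<Rightarrow> (real \<Rightarrow> real) set" where
  "functions_on I \<equiv> extensional I"

text \<open>
  The derivative is taken within \<open>{0..T}\<close>, hence is one-sided at the endpoints. The library's
  \<open>C1_differentiable_on\<close> demands two-sided derivatives and is not what is wanted here.
\<close>

definition C1_space :: "real \<Rightarrow> (real \<Rightarrow> real) set" where
  "C1_space T = {x \<in> functions_on {0..T}. \<exists>x'. continuous_on {0..T} x' \<and>
     (\<forall>t\<in>{0..T}. (x has_real_derivative x' t) (at t within {0..T}))}"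

definition memory_exponent :: "real \<Rightarrow> (real \<Rightarrow> real) \<Rightarrow> bool" where
  "memory_exponent T \<rho> \<longleftrightarrow> continuous_on {0..T} \<rho> \<and> (\<forall>t\<in>{0..T}. 0 < \<rho> t \<and> \<rho> t \<le> 1)"

definition memory_kernel :: "(real \<Rightarrow> real) \<Rightarrow> real \<Rightarrow> real \<Rightarrow> real" where
  "memory_kernel \<rho> t \<tau> = (if \<tau> < t then (t - \<tau>) powr (\<rho> t - 1) / Gamma (\<rho> t) else 0)"

definition memory_velocity ::
  "real \<Rightarrow> (real \<Rightarrow> real) \<Rightarrow> (real \<Rightarrow> real) \<Rightarrow> (real \<Rightarrow> real) \<Rightarrow> real \<Rightarrow> real" where
  "memory_velocity T \<alpha> \<beta> x = (\<lambda>t\<in>{0..T}.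
     if t = 0 then vector_derivative x (at 0 within {0..T})
     else (LINT \<tau>:{0..t}|lborel. memory_kernel \<alpha> t \<tau> * (x t - x \<tau>)) /
          (LINT \<tau>:{0..t}|lborel. memory_kernel \<beta> t \<tau> * (t - \<tau>)))"

text \<open>
  The library's \<open>linear\<close> is for maps on a whole type; this is linearity of a map from a
  linear subspace \<open>X\<close> of the real functions on \<open>I\<close> to the space of all real functions on \<open>I\<close>.
\<close>

definition function_subspace :: "real set \<Rightarrow> (real \<Rightarrow> real) set \<Rightarrow> bool" where
  "function_subspace I X \<longleftrightarrow> X \<subseteq> functions_on I \<and> (\<lambda>t\<in>I. 0) \<in> X \<and>
     (\<forall>x\<in>X. \<forall>y\<in>X. (\<lambda>t\<in>I. x t + y t) \<in> X) \<and>
     (\<forall>c. \<forall>x\<in>X. (\<lambda>t\<in>I. c * x t) \<in> X)"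

definition linear_operator_on ::
  "real set \<Rightarrow> (real \<Rightarrow> real) set \<Rightarrow> ((real \<Rightarrow> real) \<Rightarrow> real \<Rightarrow> real) \<Rightarrow> bool" where
  "linear_operator_on I X V \<longleftrightarrow> function_subspace I X \<and> V \<in> X \<rightarrow> functions_on I \<and>
     (\<forall>x\<in>X. \<forall>y\<in>X. V (\<lambda>t\<in>I. x t + y t) = (\<lambda>t\<in>I. V x t + V y t)) \<and>
     (\<forall>c. \<forall>x\<in>X. V (\<lambda>t\<in>I. c * x t) = (\<lambda>t\<in>I. c * V x t))"

end

theory Submission
  imports Defs
begin

text \<open>
  The derivative at \<open>0\<close> and the integrand of the numerator are linear in \<open>x\<close>; the point to check is that the numerator
  integral converges, since otherwise the Bochner integral has the junk value \<open>0\<close> and need not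
  be additive. The kernel has the integrable singularity \<open>(t - \<tau>) powr (\<alpha> t - 1)\<close> with
  \<open>\<alpha> t - 1 > -1\<close>, and \<open>x t - x \<tau>\<close> is bounded.
\<close>

text \<open>The gauge integral of this power is known for a > -1. Nonnegativity upgrades it to
  absolute integrability, and Borel measurability lets \<open>lborel\<close> replace its
  completion.\<close>

lemma set_integrable_powr_from_0:
  fixes a c :: real
  assumes "a > -1" "c \<ge> 0"
  shows "set_integrable lborel {0..c} (\<lambda>u. u powr a)"
proof -
  have "(\<lambda>u. u powr a) absolutely_integrable_on {0..c}"
    using has_integral_powr_from_0[OF assms]
    by (intro nonnegative_absolutely_integrable_1) (auto simp: has_integral_integrable)
  then show ?thesis
    unfolding set_integrable_def by (subst (asm) integrable_completion) auto
qed

text \<open>The reflection of \<tau> to t - \<tau> maps [0,t] onto itself and moves the singularity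
  from 0 to t.\<close>

lemma set_integrable_powr_diff:
  fixes a t :: real
  assumes "a > -1" "t \<ge> 0"
  shows "set_integrable lborel {0..t} (\<lambda>\<tau>. (t - \<tau>) powr a)"
proof -
  have "integrable lborel (\<lambda>\<tau>. indicator {0..t} (t + -1 * \<tau>) *\<^sub>R (t + -1 * \<tau>) powr a)"
    using set_integrable_powr_from_0[OF assms] unfolding set_integrable_def
    by (intro lborel_integrable_real_affine) auto
  also have "(\<lambda>\<tau>. indicator {0..t} (t + -1 * \<tau>) *\<^sub>R (t + -1 * \<tau>) powr a) =
      (\<lambda>\<tau>. indicator {0..t} \<tau> *\<^sub>R (t - \<tau>) powr a)"
    by (auto simp: indicator_def)
  finally show ?thesis unfolding set_integrable_def .
qed

text \<open>The case distinction disappears even at \<tau> = t, because \<open>0 powr a = 0\<close>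
  for every \<open>a\<close>.\<close>

lemma memory_kernel_eq:
  assumes "\<tau> \<le> t"
  shows "memory_kernel \<rho> t \<tau> = (t - \<tau>) powr (\<rho> t - 1) / Gamma (\<rho> t)"
  using assms by (auto simp: memory_kernel_def)

text \<open>A continuous factor is bounded on the compact interval, so a constant multiple of the
  integrable power dominates the product.\<close>

lemma set_integrable_memory_kernel_mult:
  assumes "\<rho> t > 0" "t \<ge> 0" "continuous_on {0..t} g"
  shows "set_integrable lborel {0..t} (\<lambda>\<tau>. memory_kernel \<rho> t \<tau> * g \<tau>)"
proof -
  have "bounded (g ` {0..t})"
    using assms(3) by (intro compact_imp_bounded compact_continuous_image) auto
  then obtain M where M: "\<And>\<tau>. \<tau> \<in> {0..t} \<Longrightarrow> \<bar>g \<tau>\<bar> \<le> M"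
    unfolding bounded_iff real_norm_def by blast
  let ?k = "\<lambda>\<tau>. (t - \<tau>) powr (\<rho> t - 1)"
  have "set_integrable lborel {0..t} (\<lambda>\<tau>. M * ?k \<tau>)"
    using assms by (intro set_integrable_mult_right set_integrable_powr_diff) auto
  then have "set_integrable lborel {0..t} (\<lambda>\<tau>. ?k \<tau> * g \<tau>)"
  proof (rule set_integrable_bound)
    \<comment> \<open>Nothing is known about \<open>g\<close> outside [0,t], so the indicator is
      attached to \<open>g\<close> to obtain a Borel function on the whole line.\<close>
    have [measurable]: "(\<lambda>\<tau>. indicator {0..t} \<tau> *\<^sub>R g \<tau>) \<in> borel_measurable borel"
      using assms(3) by (intro borel_measurable_continuous_on_indicator) auto
    have "(\<lambda>\<tau>. ?k \<tau> * (indicator {0..t} \<tau> *\<^sub>R g \<tau>)) \<in> borel_measurable borel"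
      by measurable
    then show "set_borel_measurable lborel {0..t} (\<lambda>\<tau>. ?k \<tau> * g \<tau>)"
      unfolding set_borel_measurable_def by (simp add: mult_ac)
    show "AE \<tau> in lborel. \<tau> \<in> {0..t} \<longrightarrow> norm (?k \<tau> * g \<tau>) \<le> norm (M * ?k \<tau>)"
    proof (intro AE_I2 impI)
      fix \<tau> assume "\<tau> \<in> {0..t}"
      then have "\<bar>g \<tau>\<bar> \<le> \<bar>M\<bar>" using M by fastforce
      then show "norm (?k \<tau> * g \<tau>) \<le> norm (M * ?k \<tau>)"
        by (simp add: abs_mult mult.commute mult_right_mono)
    qed
  qed
  then have "set_integrable lborel {0..t} (\<lambda>\<tau>. (?k \<tau> * g \<tau>) / Gamma (\<rho> t))"
    by (rule set_integrable_divide)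
  then show ?thesis
    by (rule iffD1[OF set_integrable_cong, rotated 3]) (auto simp: memory_kernel_eq)
qed

lemma C1_space_continuous_on:
  assumes "x \<in> C1_space T"
  shows "continuous_on {0..T} x"
  using assms unfolding C1_space_def by (blast intro: DERIV_continuous_on)

text \<open>Links the derivative that exists by \<open>C1_space\<close> to the
  \<open>vector_derivative\<close> term that gives the velocity its value at 0.\<close>

lemma C1_space_has_vector_derivative:
  assumes "x \<in> C1_space T" "t \<in> {0..T}"
  shows "(x has_vector_derivative vector_derivative x (at t within {0..T})) (at t within {0..T})"
  using assms unfolding C1_space_def
  by (auto simp: has_real_derivative_iff_has_vector_derivative vector_derivative_works[symmetric]
      intro: differentiableI_vector)

text \<open>At 0 this is linearity of the one-sided derivative. For t > 0 the three quotients share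
  a denominator that does not involve the function, so linearity of the numerator suffices.\<close>

lemma memory_velocity_lincomb:
  assumes "0 < T" "memory_exponent T \<alpha>" "x \<in> C1_space T" "y \<in> C1_space T"
  shows "memory_velocity T \<alpha> \<beta> (\<lambda>t\<in>{0..T}. c * x t + d * y t) =
    (\<lambda>t\<in>{0..T}. c * memory_velocity T \<alpha> \<beta> x t + d * memory_velocity T \<alpha> \<beta> y t)"
    (is "memory_velocity T \<alpha> \<beta> ?z = _")
proof (rule extensionalityI[of _ "{0..T}"])
  fix t assume t: "t \<in> {0..T}"
  show "memory_velocity T \<alpha> \<beta> ?z t =
    (\<lambda>t\<in>{0..T}. c * memory_velocity T \<alpha> \<beta> x t + d * memory_velocity T \<alpha> \<beta> y t) t"
  proof (cases "t = 0")
    case True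
    let ?D = "\<lambda>f :: real \<Rightarrow> real. vector_derivative f (at 0 within {0..T})"
    have "((\<lambda>t. c * x t + d * y t) has_vector_derivative c * ?D x + d * ?D y) (at 0 within {0..T})"
      using assms(1) C1_space_has_vector_derivative[OF assms(3), of 0]
        C1_space_has_vector_derivative[OF assms(4), of 0]
      by (intro derivative_intros) auto
    \<comment> \<open>Restricting to [0,T] changes no value there, and the derivative within [0,T]
      sees only those values.\<close>
    then have "(?z has_vector_derivative c * ?D x + d * ?D y) (at 0 within {0..T})"
      using assms(1) by (elim has_vector_derivative_transform[rotated 2]) auto
    \<comment> \<open>Uniqueness of the one-sided derivative requires a nondegenerate interval,
      hence 0 < T.\<close>
    then have "?D ?z = c * ?D x + d * ?D y"
      using assms(1) by (intro vector_derivative_within_closed_interval) auto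
    then show ?thesis using True assms(1) by (simp add: memory_velocity_def)
  next
    case False
    let ?N = "\<lambda>f :: real \<Rightarrow> real. LINT \<tau>:{0..t}|lborel. memory_kernel \<alpha> t \<tau> * (f t - f \<tau>)"
    have int: "set_integrable lborel {0..t} (\<lambda>\<tau>. memory_kernel \<alpha> t \<tau> * (f t - f \<tau>))"
      if "f \<in> C1_space T" for f
      using t assms(2) continuous_on_subset[OF C1_space_continuous_on[OF that], of "{0..t}"]
      by (intro set_integrable_memory_kernel_mult continuous_intros)
        (auto simp: memory_exponent_def)
    have "?N ?z = (LINT \<tau>:{0..t}|lborel. c * (memory_kernel \<alpha> t \<tau> * (x t - x \<tau>)) +
        d * (memory_kernel \<alpha> t \<tau> * (y t - y \<tau>)))"
      using t by (intro set_lebesgue_integral_cong) (auto simp: algebra_simps)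
    also have "\<dots> = c * ?N x + d * ?N y"
      \<comment> \<open>Splitting the integral of the sum is the step that requires both numerators
        to converge.\<close>
      using int[OF assms(3)] int[OF assms(4)] by (subst set_integral_add) auto
    finally show ?thesis
      using False t by (simp add: memory_velocity_def add_divide_distrib)
  qed
qed (auto simp: memory_velocity_def)

lemma C1_space_lincomb:
  assumes "x \<in> C1_space T" "y \<in> C1_space T"
  shows "(\<lambda>t\<in>{0..T}. c * x t + d * y t) \<in> C1_space T"
proof -
  obtain x' where x': "continuous_on {0..T} x'"
    "\<And>t. t \<in> {0..T} \<Longrightarrow> (x has_real_derivative x' t) (at t within {0..T})"
    using assms(1) unfolding C1_space_def by auto
  obtain y' where y': "continuous_on {0..T} y'"
    "\<And>t. t \<in> {0..T} \<Longrightarrow> (y has_real_derivative y' t) (at t within {0..T})"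
    using assms(2) unfolding C1_space_def by auto
  have "((\<lambda>t\<in>{0..T}. c * x t + d * y t) has_real_derivative c * x' t + d * y' t)
      (at t within {0..T})" if "t \<in> {0..T}" for t
  \<comment> \<open>The two functions agree on all of [0,T], so the radius 1 is an arbitrary
    choice.\<close>
  proof (rule has_field_derivative_transform_within[OF _ zero_less_one that])
    show "((\<lambda>t. c * x t + d * y t) has_real_derivative c * x' t + d * y' t) (at t within {0..T})"
      using x'(2)[OF that] y'(2)[OF that] by (auto intro!: derivative_eq_intros)
  qed auto
  moreover have "continuous_on {0..T} (\<lambda>t. c * x' t + d * y' t)"
    using x' y' by (intro continuous_intros)
  ultimately show ?thesis unfolding C1_space_def by blast
qed

lemma zero_in_C1_space: "(\<lambda>t\<in>{0..T}. 0) \<in> C1_space T"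
proof -
  have "((\<lambda>t\<in>{0..T}. 0) has_real_derivative 0) (at t within {0..T})" if "t \<in> {0..T}" for t
    by (rule has_field_derivative_transform_within[OF DERIV_const[of 0] zero_less_one that]) auto
  then show ?thesis
    unfolding C1_space_def by (auto intro!: exI[of _ "\<lambda>_. 0"])
qed

lemma function_subspace_C1_space: "function_subspace {0..T} (C1_space T)"
proof -
  have "C1_space T \<subseteq> functions_on {0..T}"
    by (auto simp: C1_space_def)
  then show ?thesis
    using C1_space_lincomb[where c = 1 and d = 1] C1_space_lincomb[where d = 0] zero_in_C1_space
    by (auto simp: function_subspace_def)
qed

theorem proposition2p1:
  fixes T :: real and \<alpha> \<beta> :: "real \<Rightarrow> real"
  assumes "0 < T"
    and "memory_exponent T \<alpha>"
    and "memory_exponent T \<beta>"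
  shows "(\<forall>x1\<in>C1_space T. \<forall>x2\<in>C1_space T. \<forall>c1 c2 :: real.
            memory_velocity T \<alpha> \<beta> (\<lambda>t\<in>{0..T}. c1 * x1 t + c2 * x2 t) =
            (\<lambda>t\<in>{0..T}. c1 * memory_velocity T \<alpha> \<beta> x1 t + c2 * memory_velocity T \<alpha> \<beta> x2 t))
       \<and> linear_operator_on {0..T} (C1_space T) (memory_velocity T \<alpha> \<beta>)"
proof -
  note lin = memory_velocity_lincomb[OF assms(1,2)]
  have "memory_velocity T \<alpha> \<beta> \<in> C1_space T \<rightarrow> functions_on {0..T}"
    by (auto simp: memory_velocity_def)
  then show ?thesis
    \<comment> \<open>Coefficients 1, 1 give additivity; d = 0 gives homogeneity, with any member of
      the space as second function.\<close>
    using lin lin[where c = 1 and d = 1] lin[where d = 0] function_subspace_C1_space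
    by (auto simp: linear_operator_on_def)
qed

end
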